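(* Let $p\ge1$, let $u\in F^1_{USCB}(X)$ and for each positive integer $n$, let $u_n\in F^1_{USC}(X)$. Then $H_{\rm send}(u_n,u)\to0$ if and only if $H([u_n]_0,[u]_0)\to0$ and $d_p(u_n,u)\to0$.
   Context: $(X,d)$ is a nonempty metric space. $X\times[0,1]$ carries the metric $\overline d((x,\alpha),(y,\beta))=d(x,y)+|\alpha-\beta|$. A fuzzy set in $X$ is a function $u:X\to[0,1]$, with $\alpha$-cuts $[u]_\alpha=\{x\in X: u(x)\ge\alpha\}$ for $\alpha\in(0,1]$ and $[u]_0=\overline{\{x\in X:u(x)>0\}}$ (closure in $X$). $F^1_{USC}(X)$ is the set of fuzzy sets $u$ in $X$ such that $[u]_\alpha$ is nonempty and closed for all $\alpha\in[0,1]$; $F^1_{USCB}(X)$ is the set of $u\in F^1_{USC}(X)$ with $[u]_0$ compact. For nonempty closed sets $A,B$, $H(A,B)=\max\{\sup_{a\in A}\inf_{b\in B}\rho(a,b),\sup_{b\in B}\inf_{a\in A}\rho(a,b)\}\in[0,+\infty]$ is the Hausdorff distance, with $\rho=d$ on $X$ and $\rho=\overline d$ on $X\times[0,1]$. The sendograph is ${\rm send}\,u=\{(x,t)\in X\times[0,1]:u(x)\ge t\}\cap([u]_0\times[0,1])$ and $H_{\rm send}(u,v)=H({\rm send}\,u,{\rm send}\,v)$. For $p\ge1$, $d_p(u,v)=(\int_0^1H([u]_\alpha,[v]_\alpha)^p\,d\alpha)^{1/p}$ (Lebesgue measure). It is a known fact that $\alpha\mapsto H([u]_\alpha,[v]_\alpha)$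 is measurable on $[0,1]$ (with values in $\mathbb R\cup\{+\infty\}$) whenever $v\in F^1_{USC}(X)$ and $u\in F^1_{USC}(X)$ has $[u]_\alpha$ compact for all $\alpha\in(0,1]$, so $d_p(u_n,u)$ is well-defined here. *)

theory Defs
  imports "HOL-Analysis.Analysis"
begin

(* A fuzzy set in X is a function u :: 'a => real with values in {0..1}; the range condition is
   part of F1_USC below. *)

definition fuzzy_cut :: "('a::metric_space \<Rightarrow> real) \<Rightarrow> real \<Rightarrow> 'a set" where
  "fuzzy_cut u \<alpha> = (if \<alpha> = 0 then closure {x. u x > 0} else {x. u x \<ge> \<alpha>})"

definition F1_USC :: "('a::metric_space \<Rightarrow> real) set" where
  "F1_USC = {u. (\<forall>x. u x \<in> {0..1}) \<and> (\<forall>\<alpha>\<in>{0..1}. fuzzy_cut u \<alpha> \<noteq> {} \<and> closed (fuzzy_cut u \<alpha>))}"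

definition F1_USCB :: "('a::metric_space \<Rightarrow> real) set" where
  "F1_USCB = {u \<in> F1_USC. compact (fuzzy_cut u 0)}"

(* Extended-valued: the distance may be infinite, and suprema and infima are taken in ennreal.
   The metric is a parameter because the metric used on X \<times> [0,1] is the sum metric, whereas the
   library's dist on 'a \<times> real is the Euclidean combination. *)
definition Hausdorff :: "('b \<Rightarrow> 'b \<Rightarrow> real) \<Rightarrow> 'b set \<Rightarrow> 'b set \<Rightarrow> ennreal" where
  "Hausdorff \<rho> A B = max (SUP a\<in>A. INF b\<in>B. ennreal (\<rho> a b)) (SUP b\<in>B. INF a\<in>A. ennreal (\<rho> a b))"

definition sum_dist :: "'a::metric_space \<times> real \<Rightarrow> 'a \<times> real \<Rightarrow> real" where
  "sum_dist = (\<lambda>(x, \<alpha>) (y, \<beta>). dist x y + \<bar>\<alpha> - \<beta>\<bar>)"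

definition sendograph :: "('a::metric_space \<Rightarrow> real) \<Rightarrow> ('a \<times> real) set" where
  "sendograph u = {(x, t). t \<in> {0..1} \<and> u x \<ge> t} \<inter> (fuzzy_cut u 0 \<times> {0..1})"

definition H_send :: "('a::metric_space \<Rightarrow> real) \<Rightarrow> ('a \<Rightarrow> real) \<Rightarrow> ennreal" where
  "H_send u v = Hausdorff sum_dist (sendograph u) (sendograph v)"

(* x powr p for p > 0, extended by \<infinity> powr p = \<infinity>; the library has no real powers on ennreal. *)
definition ennreal_powr :: "ennreal \<Rightarrow> real \<Rightarrow> ennreal" where
  "ennreal_powr x p = (if x = \<infinity> then \<infinity> else ennreal (enn2real x powr p))"

definition d_p :: "real \<Rightarrow> ('a::metric_space \<Rightarrow> real) \<Rightarrow> ('a \<Rightarrow> real) \<Rightarrow> ennreal" where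
  "d_p p u v = ennreal_powr
     (\<integral>\<^sup>+ \<alpha>. ennreal_powr (Hausdorff dist (fuzzy_cut u \<alpha>) (fuzzy_cut v \<alpha>)) p * indicator {0..1} \<alpha> \<partial>lebesgue) (1 / p)"

end

theory Submission
  imports Defs
begin

text \<open>
  Write \<open>h \<alpha> = H([v]\<^sub>\<alpha>, [u]\<^sub>\<alpha>)\<close>. Both directions are quantitative comparisons between one fuzzy set
  \<open>v\<close> and the limit \<open>u\<close>; sequences enter only at the very end.

  From cuts to sendographs: let \<open>(x, t)\<close> lie in the sendograph of \<open>v\<close>. Then \<open>x\<close> lies in every cut
  \<open>[v]\<^sub>\<alpha>\<close> with \<open>\<alpha> \<le> t\<close>. Either \<open>t\<close> is small, and a point of \<open>[u]\<^sub>0\<close> near \<open>x\<close> does the job, or some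
  \<open>\<alpha>\<close> slightly below \<open>t\<close> has \<open>h \<alpha> < e\<close>, and a point of \<open>[u]\<^sub>\<alpha>\<close> near \<open>x\<close>, paired with \<open>\<alpha>\<close>, does it.
  Otherwise \<open>h \<ge> e\<close> on an interval of length \<open>e\<close>, so that the integral of \<open>h\<^sup>p\<close> is at least
  \<open>e\<^sup>p * e\<close> (lemma \<open>sendograph_near\<close>).

  From sendographs to cuts: a sendograph distance below \<open>e\<close> says that \<open>[v]\<^sub>\<alpha>\<close> is sandwiched, up to
  \<open>e\<close>, between \<open>[u]\<close> at the levels \<open>\<alpha> - e\<close> and \<open>\<alpha> + e\<close>. Since \<open>[u]\<^sub>0\<close> is compact, the decreasing
  family of cuts of \<open>u\<close> has only finitely many jumps of size more than \<open>\<delta>\<close>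
  (lemma \<open>finitely_many_large_jumps\<close>). So \<open>h \<alpha> \<le> e + \<delta>\<close> except for \<open>\<alpha>\<close> within \<open>e\<close> of
  a finite set, and there \<open>h\<close> is still at most \<open>e\<close> plus the diameter of \<open>[u]\<^sub>0\<close>. The integral of
  \<open>h\<^sup>p\<close> is thus bounded by that of a step function that becomes small with \<open>e\<close> and \<open>\<delta>\<close>
  (lemma \<open>cut_integral_le\<close>).

  The nonnegative integral, as a supremum over simple functions below the integrand, is monotone for
  arbitrary integrands. Since \<open>h\<^sup>p\<close> is only ever compared with step functions, from below in one
  direction and from above in the other, monotonicity is all that the integral has to provide.
\<close>

section \<open>Hausdorff distance and real bounds\<close>

lemma Hausdorff_commute:
  assumes "\<And>a b. \<rho> a b = \<rho> b a"
  shows "Hausdorff \<rho> A B = Hausdorff \<rho> B A"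
  unfolding Hausdorff_def by (subst max.commute) (simp add: assms)

lemma Hausdorff_lessD:
  assumes "Hausdorff \<rho> A B < ennreal e" "a \<in> A"
  shows "\<exists>b\<in>B. \<rho> a b < e"
proof -
  have "(INF b\<in>B. ennreal (\<rho> a b)) \<le> Hausdorff \<rho> A B"
    unfolding Hausdorff_def using assms(2) by (intro max.coboundedI1 SUP_upper)
  also note assms(1)
  finally obtain b where "b \<in> B" "ennreal (\<rho> a b) < ennreal e"
    by (auto simp: INF_less_iff)
  then show ?thesis
    by (metis ennreal_leI linorder_not_le)
qed

lemma Hausdorff_leI:
  assumes "\<And>a. a \<in> A \<Longrightarrow> \<exists>b\<in>B. \<rho> a b \<le> e" "\<And>b. b \<in> B \<Longrightarrow> \<exists>a\<in>A. \<rho> a b \<le> e"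
  shows "Hausdorff \<rho> A B \<le> ennreal e"
  unfolding Hausdorff_def
proof (intro max.boundedI SUP_least)
  show "(INF b\<in>B. ennreal (\<rho> a b)) \<le> ennreal e" if "a \<in> A" for a
    using assms(1)[OF that] by (meson INF_lower2 ennreal_leI)
  show "(INF a\<in>A. ennreal (\<rho> a b)) \<le> ennreal e" if "b \<in> B" for b
    using assms(2)[OF that] by (meson INF_lower2 ennreal_leI)
qed

lemma sum_dist_commute: "sum_dist a b = sum_dist b a"
  by (simp add: sum_dist_def dist_commute abs_minus_commute split: prod.splits)

lemma H_send_commute: "H_send v w = H_send w v"
  unfolding H_send_def by (intro Hausdorff_commute sum_dist_commute)

lemma tendsto_zero_ennreal_iff:
  "((f \<longlongrightarrow> (0::ennreal)) F) \<longleftrightarrow> (\<forall>e>0. \<forall>\<^sub>F n in F. f n < ennreal e)"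
proof
  assume "(f \<longlongrightarrow> 0) F"
  then show "\<forall>e>0. \<forall>\<^sub>F n in F. f n < ennreal e"
    by (auto simp: order_tendsto_iff)
next
  assume *: "\<forall>e>0. \<forall>\<^sub>F n in F. f n < ennreal e"
  show "(f \<longlongrightarrow> 0) F"
    unfolding order_tendsto_iff
  proof (intro conjI allI impI)
    fix b :: ennreal assume "0 < b"
    then obtain c where "0 < c" "c < b"
      using dense by blast
    then obtain e where "0 < e" "c = ennreal e"
      by (cases c) auto
    then show "\<forall>\<^sub>F n in F. f n < b"
      using * \<open>c < b\<close> by (auto elim!: eventually_mono allE[of _ e] dest: less_trans)
  qed auto
qed

section \<open>Real powers of extended nonnegative reals\<close>

lemma ennreal_powr_less_iff:
  assumes "0 < p" "0 \<le> e"
  shows "ennreal_powr x p < ennreal (e powr p) \<longleftrightarrow> x < ennreal e"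
proof (cases x)
  case (real r)
  then show ?thesis
    using assms powr_mono2[of p e r] powr_less_mono2[of p r e]
    by (cases "r < e") (auto simp: ennreal_powr_def ennreal_less_iff)
qed (auto simp: ennreal_powr_def)

lemma ennreal_powr_le:
  assumes "0 < p" "0 \<le> e" "x \<le> ennreal e"
  shows "ennreal_powr x p \<le> ennreal (e powr p)"
proof (cases x)
  case (real r)
  then show ?thesis
    using assms by (auto simp: ennreal_powr_def intro!: ennreal_leI powr_mono2)
qed (use assms in \<open>auto simp: top_unique\<close>)

lemma ennreal_powr_tendsto_zero_iff:
  assumes "0 < p"
  shows "((\<lambda>n. ennreal_powr (f n) p) \<longlongrightarrow> 0) F \<longleftrightarrow> (f \<longlongrightarrow> 0) F"
proof -
  have "(\<forall>e>0. \<forall>\<^sub>F n in F. ennreal_powr (f n) p < ennreal e) \<longleftrightarrow>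
    (\<forall>e>0. \<forall>\<^sub>F n in F. ennreal_powr (f n) p < ennreal (e powr p))"
  proof safe
    fix e :: real
    assume *: "\<forall>e>0. \<forall>\<^sub>F n in F. ennreal_powr (f n) p < ennreal (e powr p)" and "0 < e"
    then have "(e powr (1 / p)) powr p = e" "0 < e powr (1 / p)"
      using assms by (simp_all add: powr_powr)
    then show "\<forall>\<^sub>F n in F. ennreal_powr (f n) p < ennreal e"
      using * by metis
  qed auto
  also have "\<dots> \<longleftrightarrow> (\<forall>e>0. \<forall>\<^sub>F n in F. f n < ennreal e)"
    by (simp add: ennreal_powr_less_iff assms)
  finally show ?thesis
    unfolding tendsto_zero_ennreal_iff .
qed

section \<open>Cuts and sendographs\<close>

abbreviation cut_dist :: "('a::metric_space \<Rightarrow> real) \<Rightarrow> ('a \<Rightarrow> real) \<Rightarrow> real \<Rightarrow> ennreal" where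
  "cut_dist v w \<alpha> \<equiv> Hausdorff dist (fuzzy_cut v \<alpha>) (fuzzy_cut w \<alpha>)"

text \<open>This is the \<open>p\<close>-th power of \<^const>\<open>d_p\<close>.\<close>

definition cut_integral :: "real \<Rightarrow> ('a::metric_space \<Rightarrow> real) \<Rightarrow> ('a \<Rightarrow> real) \<Rightarrow> ennreal" where
  "cut_integral p v w = (\<integral>\<^sup>+ \<alpha>. ennreal_powr (cut_dist v w \<alpha>) p * indicator {0..1} \<alpha> \<partial>lebesgue)"

lemma cut_dist_commute: "cut_dist v w \<alpha> = cut_dist w v \<alpha>"
  by (intro Hausdorff_commute dist_commute)

lemma cut_integral_commute: "cut_integral p v w = cut_integral p w v"
  unfolding cut_integral_def by (subst cut_dist_commute) (rule refl)

lemma F1_USC_range: "u \<in> F1_USC \<Longrightarrow> 0 \<le> u x \<and> u x \<le> 1"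
  by (auto simp: F1_USC_def)

lemma fuzzy_cut_pos: "0 < \<alpha> \<Longrightarrow> fuzzy_cut u \<alpha> = {x. \<alpha> \<le> u x}"
  by (simp add: fuzzy_cut_def)

lemma fuzzy_cut_zeroI: "0 < u x \<Longrightarrow> x \<in> fuzzy_cut u 0"
  using closure_subset by (fastforce simp: fuzzy_cut_def)

lemma fuzzy_cut_subset_zero: "0 \<le> \<alpha> \<Longrightarrow> fuzzy_cut u \<alpha> \<subseteq> fuzzy_cut u 0"
  by (cases "\<alpha> = 0") (auto simp: fuzzy_cut_pos intro: fuzzy_cut_zeroI)

lemma mem_sendograph:
  "(x, t) \<in> sendograph u \<longleftrightarrow> 0 \<le> t \<and> t \<le> 1 \<and> t \<le> u x \<and> x \<in> fuzzy_cut u 0"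
  by (auto simp: sendograph_def)

lemma sendograph_base:
  "u \<in> F1_USC \<Longrightarrow> (x, 0) \<in> sendograph u \<longleftrightarrow> x \<in> fuzzy_cut u 0"
  by (simp add: mem_sendograph F1_USC_range)

section \<open>Close cuts give close sendographs\<close>

text \<open>
  If the distance of the cuts were at least \<open>e\<close> on the whole interval below \<open>t\<close> of length \<open>e\<close>, that
  interval alone would contribute \<open>e powr p * e\<close> to the integral.
\<close>

lemma ex_cut_dist_less:
  assumes "0 < p" "0 < e" "e \<le> t" "t \<le> 1"
    and small: "cut_integral p v w < ennreal (e powr p * e)"
  shows "\<exists>\<alpha>. t - e < \<alpha> \<and> \<alpha> < t \<and> cut_dist v w \<alpha> < ennreal e"
proof (rule ccontr)
  assume "\<not> ?thesis"
  then have large: "ennreal (e powr p) \<le> ennreal_powr (cut_dist v w \<alpha>) p" if "\<alpha> \<in> {t - e<..<t}" for \<alpha>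
    using that ennreal_powr_less_iff[of p e "cut_dist v w \<alpha>"] assms(1,2)
    by (auto simp: not_less[symmetric])
  have "ennreal (e powr p * e) = (\<integral>\<^sup>+ \<alpha>. ennreal (e powr p) * indicator {t - e<..<t} \<alpha> \<partial>lebesgue)"
    using assms(2) by (simp add: nn_integral_cmult_indicator ennreal_mult)
  also have "\<dots> \<le> cut_integral p v w"
    unfolding cut_integral_def using assms large
    by (intro nn_integral_mono) (auto simp: indicator_def)
  finally show False
    using small by simp
qed

text \<open>
  The point \<open>(x, t)\<close> is replaced by one at a slightly lower level, since \<open>x\<close> stays in the cuts below
  \<open>t\<close>. A level below \<open>e\<close> may be lowered to 0, where closeness of the supports applies.
\<close>

lemma sendograph_near:
  assumes vw: "v \<in> F1_USC" "w \<in> F1_USC" and "0 < p" "0 < e"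
    and base: "cut_dist v w 0 < ennreal e"
    and small: "cut_integral p v w < ennreal (e powr p * e)"
    and mem: "(x, t) \<in> sendograph v"
  shows "\<exists>q\<in>sendograph w. sum_dist (x, t) q \<le> 2 * e"
proof (cases "t < e")
  case True
  have "x \<in> fuzzy_cut v 0" "0 \<le> t"
    using mem by (auto simp: mem_sendograph)
  with Hausdorff_lessD[OF base] obtain y where "y \<in> fuzzy_cut w 0" "dist x y < e"
    by blast
  with vw True \<open>0 \<le> t\<close> show ?thesis
    by (intro bexI[of _ "(y, 0)"]) (auto simp: sendograph_base sum_dist_def)
next
  case False
  with mem ex_cut_dist_less[OF \<open>0 < p\<close> \<open>0 < e\<close> _ _ small, of t]
  obtain \<alpha> where \<alpha>: "t - e < \<alpha>" "\<alpha> < t" "cut_dist v w \<alpha> < ennreal e"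
    by (auto simp: mem_sendograph)
  have t: "0 < \<alpha>" "t \<le> 1" "t \<le> v x"
    using False \<alpha> mem by (auto simp: mem_sendograph)
  then have "x \<in> fuzzy_cut v \<alpha>"
    using \<alpha> by (simp add: fuzzy_cut_pos)
  with Hausdorff_lessD[OF \<alpha>(3)] obtain y where y: "y \<in> fuzzy_cut w \<alpha>" "dist x y < e"
    by blast
  then have "(y, \<alpha>) \<in> sendograph w"
    using t \<alpha> fuzzy_cut_zeroI[of w y] by (auto simp: mem_sendograph fuzzy_cut_pos)
  then show ?thesis
    using y \<alpha> by (intro bexI[of _ "(y, \<alpha>)"]) (auto simp: sum_dist_def)
qed

lemma H_send_le:
  assumes "v \<in> F1_USC" "w \<in> F1_USC" "0 < p" "0 < e"
    and "cut_dist v w 0 < ennreal e" "cut_integral p v w < ennreal (e powr p * e)"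
  shows "H_send v w \<le> ennreal (2 * e)"
  unfolding H_send_def
proof (rule Hausdorff_leI)
  show "\<exists>b\<in>sendograph w. sum_dist a b \<le> 2 * e" if "a \<in> sendograph v" for a
    using that sendograph_near[OF assms] by (cases a) blast
  show "\<exists>a\<in>sendograph v. sum_dist a b \<le> 2 * e" if "b \<in> sendograph w" for b
  proof -
    have "\<exists>a\<in>sendograph v. sum_dist b a \<le> 2 * e"
      using that assms sendograph_near[of w v p e]
      by (cases b) (auto simp: cut_dist_commute[where v = w and w = v] cut_integral_commute[of p w v])
    then show ?thesis
      by (simp add: sum_dist_commute)
  qed
qed

section \<open>Close sendographs give close cuts\<close>

lemma sendograph_near_base:
  assumes "v \<in> F1_USC" "H_send v w < ennreal e" "x \<in> fuzzy_cut v 0"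
  shows "\<exists>y\<in>fuzzy_cut w 0. dist x y < e"
proof -
  obtain y t where "(y, t) \<in> sendograph w" "sum_dist (x, 0) (y, t) < e"
    using Hausdorff_lessD[OF assms(2)[unfolded H_send_def], of "(x, 0)"] assms(1,3)
    by (auto simp: sendograph_base)
  then show ?thesis
    by (intro bexI[of _ y]) (auto simp: mem_sendograph sum_dist_def)
qed

lemma cut_dist_zero_le:
  assumes "v \<in> F1_USC" "w \<in> F1_USC" "H_send v w < ennreal e"
  shows "cut_dist v w 0 \<le> ennreal e"
proof (rule Hausdorff_leI)
  show "\<exists>b\<in>fuzzy_cut w 0. dist a b \<le> e" if "a \<in> fuzzy_cut v 0" for a
    using sendograph_near_base[OF assms(1,3) that] by force
  show "\<exists>a\<in>fuzzy_cut v 0. dist a b \<le> e" if "b \<in> fuzzy_cut w 0" for b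
    using sendograph_near_base[of w v e b] assms that
    by (force simp: H_send_commute[of w v] dist_commute)
qed

text \<open>
  Moving to a nearby point of the other sendograph costs at most \<open>e\<close> in the level as well.
\<close>

lemma sendograph_near_level:
  assumes "H_send v w < ennreal e" "0 < \<alpha>" "\<alpha> \<le> 1" "\<alpha> \<le> v x"
  shows "\<exists>y. \<alpha> - e \<le> w y \<and> dist x y < e"
proof -
  have "(x, \<alpha>) \<in> sendograph v"
    using assms fuzzy_cut_zeroI[of v x] by (auto simp: mem_sendograph)
  then obtain y t where "(y, t) \<in> sendograph w" "sum_dist (x, \<alpha>) (y, t) < e"
    using Hausdorff_lessD[OF assms(1)[unfolded H_send_def]] by force
  then have "t \<le> w y" "dist x y + \<bar>\<alpha> - t\<bar> < e"
    by (auto simp: mem_sendograph sum_dist_def)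
  then show ?thesis
    using zero_le_dist[of x y] by (intro exI[of _ y]) linarith
qed

text \<open>
  Cover the compact set \<open>[u]\<^sub>0\<close> by finitely many balls of diameter at most \<open>\<delta>\<close>. As the level rises,
  the cuts of \<open>u\<close> leave each ball for good at one level, the supremum of \<open>u\<close> on that ball. Between
  two levels with no such supremum in between, the cuts meet the same balls, so that each point of
  the larger cut has a point of the smaller one in its own ball.
\<close>

lemma finitely_many_large_jumps:
  assumes le1: "\<And>x. u x \<le> (1::real)" and "compact (fuzzy_cut u 0)" "0 < \<delta>"
  obtains S where "finite S"
    "\<And>a b x. \<lbrakk>0 < a; a \<le> b; S \<inter> {a..b} = {}; a \<le> u x\<rbrakk> \<Longrightarrow> \<exists>y. b \<le> u y \<and> dist x y \<le> \<delta>"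
proof -
  have "fuzzy_cut u 0 \<subseteq> (\<Union>c. ball c (\<delta> / 2))"
  proof
    show "x \<in> (\<Union>c. ball c (\<delta> / 2))" for x
      using \<open>0 < \<delta>\<close> by (intro UN_I[of x]) auto
  qed
  then obtain C where C: "finite C" "fuzzy_cut u 0 \<subseteq> (\<Union>c\<in>C. ball c (\<delta> / 2))"
    using compactE_image[OF assms(2), of UNIV "\<lambda>c. ball c (\<delta> / 2)"] by auto
  define s where "s c = Sup (u ` ball c (\<delta> / 2))" for c
  have bdd: "bdd_above (u ` A)" for A
    using le1 by (auto simp: bdd_above_def)
  show ?thesis
  proof (rule that[of "s ` C"])
    show "finite (s ` C)"
      using C by simp
    fix a b x
    assume ab: "0 < a" "a \<le> b" "s ` C \<inter> {a..b} = {}" and x: "a \<le> u x"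
    then have "x \<in> fuzzy_cut u 0"
      by (intro fuzzy_cut_zeroI) simp
    then obtain c where c: "c \<in> C" "x \<in> ball c (\<delta> / 2)"
      using C by blast
    have "u x \<le> s c"
      unfolding s_def using c bdd by (intro cSup_upper) auto
    then have "b < s c"
      using ab x c by force
    then obtain y where y: "y \<in> ball c (\<delta> / 2)" "b < u y"
      using less_cSup_iff[OF _ bdd, of "ball c (\<delta> / 2)" b] c unfolding s_def by blast
    have "dist x y \<le> \<delta>"
      using c y dist_triangle2[of x y c] by (simp add: dist_commute)
    then show "\<exists>y. b \<le> u y \<and> dist x y \<le> \<delta>"
      using y by (intro exI[of _ y]) simp
  qed
qed

text \<open>
  Up to \<open>e\<close>, the cut of \<open>v\<close> at \<open>\<alpha>\<close> lies between the cuts of \<open>u\<close> at \<open>\<alpha> + e\<close> and \<open>\<alpha> - e\<close>, and so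
  does the cut of \<open>u\<close> at \<open>\<alpha>\<close>. When these two outer cuts are \<open>\<delta>\<close>-close, so are the inner ones up to \<open>e + \<delta>\<close>.
\<close>

lemma cut_dist_le_away_from_jumps:
  assumes near: "H_send v u < ennreal e" and "0 < e" "e < \<alpha>" "\<alpha> + e \<le> 1"
    and no_jump: "\<And>x. \<alpha> - e \<le> u x \<Longrightarrow> \<exists>y. \<alpha> + e \<le> u y \<and> dist x y \<le> \<delta>"
  shows "cut_dist v u \<alpha> \<le> ennreal (e + \<delta>)"
proof (rule Hausdorff_leI)
  fix x assume "x \<in> fuzzy_cut v \<alpha>"
  then obtain y where y: "\<alpha> - e \<le> u y" "dist x y < e"
    using sendograph_near_level[OF near, of \<alpha> x] assms by (auto simp: fuzzy_cut_pos)
  then obtain z where z: "\<alpha> + e \<le> u z" "dist y z \<le> \<delta>"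
    using no_jump by blast
  then show "\<exists>z\<in>fuzzy_cut u \<alpha>. dist x z \<le> e + \<delta>"
    using y assms dist_triangle[of x z y]
    by (intro bexI[of _ z]) (auto simp: fuzzy_cut_pos)
next
  fix y assume "y \<in> fuzzy_cut u \<alpha>"
  then obtain z where z: "\<alpha> + e \<le> u z" "dist y z \<le> \<delta>"
    using no_jump[of y] \<open>0 < e\<close> \<open>e < \<alpha>\<close> by (fastforce simp: fuzzy_cut_pos)
  then obtain x where x: "\<alpha> \<le> v x" "dist z x < e"
    using sendograph_near_level[of u v e "\<alpha> + e" z] assms
    by (auto simp: H_send_commute[of u v])
  then show "\<exists>x\<in>fuzzy_cut v \<alpha>. dist x y \<le> e + \<delta>"
    using z assms dist_triangle[of y x z]
    by (intro bexI[of _ x]) (auto simp: fuzzy_cut_pos dist_commute)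
qed

text \<open>
  Near the jumps of \<open>u\<close> only boundedness remains: all cuts of \<open>v\<close> lie within \<open>e\<close> of \<open>[u]\<^sub>0\<close>.
\<close>

lemma cut_dist_le_diameter:
  assumes vu: "v \<in> F1_USC" "u \<in> F1_USC" and near: "H_send v u < ennreal e"
    and \<alpha>: "\<alpha> \<in> {0..1}"
    and D: "\<And>x y. \<lbrakk>x \<in> fuzzy_cut u 0; y \<in> fuzzy_cut u 0\<rbrakk> \<Longrightarrow> dist x y \<le> D"
  shows "cut_dist v u \<alpha> \<le> ennreal (e + D)"
proof -
  have all: "dist x y \<le> e + D" if "x \<in> fuzzy_cut v \<alpha>" "y \<in> fuzzy_cut u \<alpha>" for x y
  proof -
    have mem: "x \<in> fuzzy_cut v 0" "y \<in> fuzzy_cut u 0"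
      using that \<alpha> fuzzy_cut_subset_zero[of \<alpha>] by auto
    then obtain z where "z \<in> fuzzy_cut u 0" "dist x z < e"
      using sendograph_near_base[OF vu(1) near] by blast
    then show ?thesis
      using D[OF _ mem(2), of z] dist_triangle[of x y z] by simp
  qed
  have "fuzzy_cut v \<alpha> \<noteq> {}" "fuzzy_cut u \<alpha> \<noteq> {}"
    using vu \<alpha> by (auto simp: F1_USC_def)
  then show ?thesis
    using all by (intro Hausdorff_leI) blast+
qed

text \<open>
  The two bounds combine into a step function: the levels within \<open>e\<close> of \<open>S\<close> have total length at most
  \<open>card S * (2 * e)\<close>.
\<close>

lemma cut_integral_le:
  assumes vu: "v \<in> F1_USC" "u \<in> F1_USC" and near: "H_send v u < ennreal e"
    and pos: "0 < p" "0 < e" "0 \<le> \<delta>" "0 \<le> D"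
    and D: "\<And>x y. \<lbrakk>x \<in> fuzzy_cut u 0; y \<in> fuzzy_cut u 0\<rbrakk> \<Longrightarrow> dist x y \<le> D"
    and S: "finite S" "0 \<in> S" "1 \<in> S"
    and jumps: "\<And>a b x. \<lbrakk>0 < a; a \<le> b; S \<inter> {a..b} = {}; a \<le> u x\<rbrakk>
      \<Longrightarrow> \<exists>y. b \<le> u y \<and> dist x y \<le> \<delta>"
  shows "cut_integral p v u \<le>
    ennreal ((e + \<delta>) powr p + (e + D) powr p * (real (card S) * (2 * e)))"
proof -
  define B where "B = (\<Union>s\<in>S. {s - e..s + e})"
  have meas: "B \<in> sets lebesgue"
    unfolding B_def using S by (intro sets.finite_UN) auto
  have B_le: "emeasure lebesgue B \<le> ennreal (real (card S) * (2 * e))"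
  proof -
    have "emeasure lebesgue B \<le> (\<Sum>s\<in>S. emeasure lebesgue {s - e..s + e})"
      unfolding B_def using S by (intro emeasure_subadditive_finite) auto
    also have "\<dots> = ennreal (real (card S) * (2 * e))"
      using pos by (simp add: ennreal_mult ennreal_of_nat_eq_real_of_nat)
    finally show ?thesis .
  qed
  have bound: "ennreal_powr (cut_dist v u \<alpha>) p \<le>
    ennreal ((e + \<delta>) powr p) + ennreal ((e + D) powr p) * indicator B \<alpha>" if \<alpha>: "\<alpha> \<in> {0..1}" for \<alpha>
  proof (cases "\<alpha> \<in> B")
    case True
    have "ennreal_powr (cut_dist v u \<alpha>) p \<le> ennreal ((e + D) powr p)"
      using cut_dist_le_diameter[OF vu near \<alpha> D] pos by (intro ennreal_powr_le) auto
    then show ?thesis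
      using True by (simp add: add_increasing)
  next
    case False
    then have far: "\<not> (s - e \<le> \<alpha> \<and> \<alpha> \<le> s + e)" if "s \<in> S" for s
      using that by (auto simp: B_def)
    \<comment> \<open>The points 0 and 1 of \<open>S\<close> keep both levels \<open>\<alpha> - e\<close> and \<open>\<alpha> + e\<close> inside the unit interval.\<close>
    have "e < \<alpha>" "\<alpha> + e \<le> 1"
      using far[OF S(2)] far[OF S(3)] \<alpha> pos by auto
    moreover have "S \<inter> {\<alpha> - e..\<alpha> + e} = {}"
      using far by force
    ultimately have "cut_dist v u \<alpha> \<le> ennreal (e + \<delta>)"
      using pos by (intro cut_dist_le_away_from_jumps[OF near] jumps) auto
    then show ?thesis
      using False pos by (simp add: ennreal_powr_le)
  qed
  have "cut_integral p v u \<le> (\<integral>\<^sup>+ \<alpha>. ennreal ((e + \<delta>) powr p) * indicator {0..1} \<alpha> +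
      ennreal ((e + D) powr p) * indicator B \<alpha> \<partial>lebesgue)"
    unfolding cut_integral_def using bound
    by (intro nn_integral_mono) (auto split: split_indicator)
  also have "\<dots> = (\<integral>\<^sup>+ \<alpha>. ennreal ((e + \<delta>) powr p) * indicator {0..1::real} \<alpha> \<partial>lebesgue) +
      (\<integral>\<^sup>+ \<alpha>. ennreal ((e + D) powr p) * indicator B \<alpha> \<partial>lebesgue)"
    by (intro nn_integral_add borel_measurable_times_ennreal borel_measurable_const
        borel_measurable_indicator meas) simp
  also have "\<dots> = ennreal ((e + \<delta>) powr p) * emeasure lebesgue {0..1::real} +
      ennreal ((e + D) powr p) * emeasure lebesgue B"
    by (intro arg_cong2[of _ _ _ _ "(+)"] nn_integral_cmult_indicator meas) simp
  also have "emeasure lebesgue {0..1::real} = 1"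
    by simp
  also have "ennreal ((e + \<delta>) powr p) * 1 + ennreal ((e + D) powr p) * emeasure lebesgue B \<le>
      ennreal ((e + \<delta>) powr p) * 1 + ennreal ((e + D) powr p) * ennreal (real (card S) * (2 * e))"
    by (rule add_left_mono, rule mult_left_mono) (use B_le in auto)
  also have "\<dots> = ennreal ((e + \<delta>) powr p + (e + D) powr p * (real (card S) * (2 * e)))"
    using pos by (simp add: ennreal_mult)
  finally show ?thesis .
qed

text \<open>
  The order of the choices matters: the number of jumps depends on \<open>\<delta>\<close>, so \<open>\<delta>\<close> is fixed by \<open>\<eta>\<close>
  first, and \<open>e\<close> is then made small compared with that number.
\<close>

lemma cut_integral_less_if_H_send_less:
  assumes "u \<in> F1_USCB" "0 < p" "0 < \<eta>"
  obtains e where "0 < e" "\<And>v. \<lbrakk>v \<in> F1_USC; H_send v u < ennreal e\<rbrakk> \<Longrightarrow> cut_integral p v u < ennreal \<eta>"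
proof -
  have u: "u \<in> F1_USC" and comp: "compact (fuzzy_cut u 0)"
    using assms(1) by (auto simp: F1_USCB_def)
  \<comment> \<open>With \<open>e \<le> \<delta>\<close>, the levels away from the jumps contribute at most \<open>(2 * \<delta>) powr p = \<eta> / 2\<close>.\<close>
  define \<delta> where "\<delta> = (\<eta> / 2) powr (1 / p) / 2"
  have \<delta>: "0 < \<delta>" "(2 * \<delta>) powr p = \<eta> / 2"
    using assms by (auto simp: \<delta>_def powr_powr)
  obtain S0 where S0: "finite S0" "\<And>a b x. \<lbrakk>0 < a; a \<le> b; S0 \<inter> {a..b} = {}; a \<le> u x\<rbrakk>
      \<Longrightarrow> \<exists>y. b \<le> u y \<and> dist x y \<le> \<delta>"
    using finitely_many_large_jumps[OF _ comp \<delta>(1)] u F1_USC_range by metis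
  define S where "S = insert 0 (insert 1 S0)"
  define D where "D = diameter (fuzzy_cut u 0)"
  have bdd: "bounded (fuzzy_cut u 0)"
    using comp by (rule compact_imp_bounded)
  have D: "0 \<le> D" "\<And>x y. \<lbrakk>x \<in> fuzzy_cut u 0; y \<in> fuzzy_cut u 0\<rbrakk> \<Longrightarrow> dist x y \<le> D"
    unfolding D_def using bdd by (auto intro: diameter_ge_0 diameter_bounded_bound)
  \<comment> \<open>With \<open>e \<le> 1\<close>, the levels near the jumps contribute at most \<open>2 * M * e\<close>.\<close>
  define M where "M = (1 + D) powr p * real (card S)"
  have "0 \<le> M"
    by (simp add: M_def)
  define e where "e = min (min \<delta> 1) (\<eta> / (4 * (M + 1)))"
  have e: "0 < e" "e \<le> \<delta>" "e \<le> 1" "e \<le> \<eta> / (4 * (M + 1))"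
    using \<delta>(1) \<open>0 \<le> M\<close> \<open>0 < \<eta>\<close> by (auto simp: e_def)
  show ?thesis
  proof (rule that[OF e(1)])
    fix v :: "'a \<Rightarrow> real"
    assume v: "v \<in> F1_USC" and near: "H_send v u < ennreal e"
    have "(e + \<delta>) powr p \<le> \<eta> / 2"
      unfolding \<delta>(2)[symmetric] using e \<delta>(1) assms by (intro powr_mono2) auto
    moreover have "(e + D) powr p * (real (card S) * (2 * e)) < \<eta> / 2"
    proof -
      have "(e + D) powr p * (real (card S) * (2 * e)) \<le> (1 + D) powr p * (real (card S) * (2 * e))"
        using e D(1) assms by (intro mult_right_mono powr_mono2) auto
      also have "\<dots> = 2 * (M * e)"
        by (simp add: M_def)
      also have "\<dots> < 2 * ((M + 1) * e)"
        using e by simp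
      also have "\<dots> \<le> \<eta> / 2"
        using e(4) \<open>0 \<le> M\<close> by (simp add: field_simps)
      finally show ?thesis .
    qed
    ultimately have "(e + \<delta>) powr p + (e + D) powr p * (real (card S) * (2 * e)) < \<eta>"
      by linarith
    moreover have "cut_integral p v u \<le>
        ennreal ((e + \<delta>) powr p + (e + D) powr p * (real (card S) * (2 * e)))"
      using \<delta>(1) e D assms S0
      by (intro cut_integral_le[OF v u near]) (auto simp: S_def)
    ultimately show "cut_integral p v u < ennreal \<eta>"
      using \<open>0 < \<eta>\<close> by (auto intro: le_less_trans simp: ennreal_lessI)
  qed
qed

section \<open>Convergence\<close>

theorem proposition6p4:
  fixes p :: real and u :: "'a::metric_space \<Rightarrow> real" and un :: "nat \<Rightarrow> 'a \<Rightarrow> real"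
  assumes "p \<ge> 1"
    and "u \<in> F1_USCB"
    and "\<And>n. n \<ge> 1 \<Longrightarrow> un n \<in> F1_USC"
  shows "((\<lambda>n. H_send (un n) u) \<longlonglongrightarrow> 0) \<longleftrightarrow>
    ((\<lambda>n. Hausdorff dist (fuzzy_cut (un n) 0) (fuzzy_cut u 0)) \<longlonglongrightarrow> 0) \<and> ((\<lambda>n. d_p p (un n) u) \<longlonglongrightarrow> 0)"
proof -
  have p: "0 < p" and u: "u \<in> F1_USC"
    using assms by (auto simp: F1_USCB_def)
  have un: "\<forall>\<^sub>F n in sequentially. un n \<in> F1_USC"
    using eventually_ge_at_top[of 1] by eventually_elim (rule assms(3))
  have "((\<lambda>n. d_p p (un n) u) \<longlonglongrightarrow> 0) \<longleftrightarrow> ((\<lambda>n. cut_integral p (un n) u) \<longlonglongrightarrow> 0)"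
    unfolding d_p_def cut_integral_def[symmetric]
    using p by (intro ennreal_powr_tendsto_zero_iff) simp
  moreover have "(\<lambda>n. cut_dist (un n) u 0) \<longlonglongrightarrow> 0" if "(\<lambda>n. H_send (un n) u) \<longlonglongrightarrow> 0"
    unfolding tendsto_zero_ennreal_iff
  proof (intro allI impI)
    fix e :: real assume "0 < e"
    then have "\<forall>\<^sub>F n in sequentially. H_send (un n) u < ennreal (e / 2)"
      using that by (simp add: tendsto_zero_ennreal_iff)
    then show "\<forall>\<^sub>F n in sequentially. cut_dist (un n) u 0 < ennreal e"
      using un
    proof eventually_elim
      case (elim n)
      have "cut_dist (un n) u 0 \<le> ennreal (e / 2)"
        using cut_dist_zero_le[OF elim(2) u elim(1)] .
      also have "\<dots> < ennreal e"
        using \<open>0 < e\<close> by (intro ennreal_lessI) auto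
      finally show ?case .
    qed
  qed
  moreover have "(\<lambda>n. cut_integral p (un n) u) \<longlonglongrightarrow> 0" if "(\<lambda>n. H_send (un n) u) \<longlonglongrightarrow> 0"
    unfolding tendsto_zero_ennreal_iff
  proof (intro allI impI)
    fix \<eta> :: real assume "0 < \<eta>"
    then obtain e where e: "0 < e"
      "\<And>v. \<lbrakk>v \<in> F1_USC; H_send v u < ennreal e\<rbrakk> \<Longrightarrow> cut_integral p v u < ennreal \<eta>"
      using cut_integral_less_if_H_send_less[OF assms(2) p] by metis
    then have "\<forall>\<^sub>F n in sequentially. H_send (un n) u < ennreal e"
      using that by (simp add: tendsto_zero_ennreal_iff)
    then show "\<forall>\<^sub>F n in sequentially. cut_integral p (un n) u < ennreal \<eta>"
      using un by eventually_elim (rule e(2))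
  qed
  moreover have "(\<lambda>n. H_send (un n) u) \<longlonglongrightarrow> 0"
    if "(\<lambda>n. cut_dist (un n) u 0) \<longlonglongrightarrow> 0" "(\<lambda>n. cut_integral p (un n) u) \<longlonglongrightarrow> 0"
    unfolding tendsto_zero_ennreal_iff
  proof (intro allI impI)
    fix e :: real assume "0 < e"
    define r where "r = e / 3"
    have r: "0 < r" "0 < r powr p * r" "2 * r < e"
      using \<open>0 < e\<close> by (auto simp: r_def)
    have "\<forall>\<^sub>F n in sequentially. cut_dist (un n) u 0 < ennreal r"
      "\<forall>\<^sub>F n in sequentially. cut_integral p (un n) u < ennreal (r powr p * r)"
      using that r(1,2) unfolding tendsto_zero_ennreal_iff by blast+
    then show "\<forall>\<^sub>F n in sequentially. H_send (un n) u < ennreal e"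
      using un
    proof eventually_elim
      case (elim n)
      have "H_send (un n) u \<le> ennreal (2 * r)"
        using H_send_le[OF elim(3) u p r(1) elim(1,2)] .
      also have "\<dots> < ennreal e"
        using r \<open>0 < e\<close> by (intro ennreal_lessI)
      finally show ?case .
    qed
  qed
  ultimately show ?thesis
    by blast
qed

end
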